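(* Let $m,p,d\ge 1$ be integers with $r:=p-m\ge 0$ and $s:=d-p-m\ge 0$, put $q:=d-p$, and let $1\le n\le m$ and $t>0$. Consider the moment formula, recalled in the context, which expresses the $n$-th moment $M_n(t)=\mathbb{E}(\mathrm{tr}(J_t^n))$ of the $m\times m$ Hermitian Jacobi process of parameters $(p,q)$ as $M_n(\infty)$ plus a double sum over hooks $\alpha$ with $|\alpha|=n$ and non-empty hooks $\tau\subseteq\alpha$. This formula may be written as a linear combination of terminating balanced ${}_4F_3$-series evaluated at unit argument (the additive term $M_n(\infty)$ being kept apart), as follows. Reverse the order of summation, fix a hook $\tau=(h-j,1^j)$ with $1\le h\le n$ and $0\le j\le h-1$, and sum over the hooks $\alpha=(n-k,1^k)$, $j\le k\le j+n-h$, of weight $n$ containing $\tau$. After extraction of the factors of the summand that depend on $\alpha$ (the remaining factors depend on $\tau$ but not on $\alpha$), one is led to the alternating sum $$S_{h,j}=\sum_{k = j}^{j+n-h} \frac{(-1)^{k}\,\Gamma(n-k+m)\,\Gamma(p+n-k)\,\Gamma(d-k-j-1)}{(n-h+j-k)!\,(k- j)!\,\Gamma(m-k)\,\Gamma(p-k)\,\Gamma(d+n-k+h-j)},$$ which, by the index change $k\mapsto n-h+j-k$, equals $$(-1)^{n-h+j}\sum_{k=0}^{n-h}\frac{(-1)^{k}\,\Gamma(h-j+m+k)\,\Gamma(p+h-j+k)\,\Gamma(d-n+h-2j-1+k)}{k!\,(n-h-k)!\,\Gamma(m+h-n-j+k)\,\Gamma(p+h-n-j+k)\,\Gamma(d+k+2h-2j)},$$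 and hence $$S_{h,j}=\frac{(-1)^{n-h+j}\,\Gamma(h-j+m)\,\Gamma(p+h-j)\,\Gamma(d-n+h-2j-1)}{(n-h)!\,\Gamma(d+2h-2j)\,\Gamma(m+h-n-j)\,\Gamma(p+h-n-j)}\; {}_4F_3\left(\begin{matrix} -(n-h),\ m+h-j,\ p+h-j,\ d-n+h-2j-1 \\ m-n+h-j,\ p-n+h-j,\ d+2h-2j \end{matrix};\,1\right).$$ This ${}_4F_3$-series is balanced, i.e. one plus the sum of the upper parameters equals the sum of the lower parameters.
   Context: **Partitions.** A partition $\tau=(\tau_1\ge\tau_2\ge\cdots\ge 0)$ has weight $|\tau|=\sum_i\tau_i$ and length $l(\tau)$, the number of nonzero parts; it is padded by zeros when needed. A hook of weight $n$ is a partition $(n-k,1^k)$, $0\le k\le n-1$ (first part $n-k$ followed by $k$ ones). $\tau\subseteq\alpha$ means $\tau_i\le\alpha_i$ for all $i$. For $l(\tau)\le m$, $$\nu_{\tau}=\sum_{i=1}^m\tau_i(\tau_i+r+s+1+2(m-i)).$$ **Hermitian Jacobi process.** Let $Y=(Y_t)_{t\ge 0}$ be the Brownian motion on the unitary group $U(d)$ started at the identity, and let $X_t$ be the upper left $m\times p$ corner of $Y_t$. Then $J_t=X_tX_t^*$ is the Hermitian Jacobi process of size $m\times m$ and parameters $(p,q)$, $q=d-p$. With $r=p-m\ge0$ and $s=d-p-m\ge 0$, the Brownian motion is normalized so that for $t>0$ the eigenvalues of $J_t$, in decreasing order, have on $\{0<y_m<\cdots<y_1<1\}$ the density $$G_t^{r,s,m}(1^m,y)=\sum_{\tau:\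 l(\tau)\le m}e^{-\nu_\tau t}\Big(\prod_{j=1}^m\frac{1}{\|\tilde P^{r,s}_{\tau_j+m-j}\|_2^2}\Big)\tilde P_\tau^{r,s,m}(1^m)\,\tilde P_\tau^{r,s,m}(y)\,W^{r,s,m}(y).$$ Here $1^m=(1,\dots,1)$ ($m$ times); $\tilde{P}_k^{r,s}(u)=\frac{(r+1)_k}{k!}\,{}_2F_1(-k,k+r+s+1;r+1;u)$; $\|\cdot\|_2$ is the norm of $L^2([0,1],u^r(1-u)^sdu)$; $$\tilde P_\tau^{r,s,m}(x)=\frac{\det(\tilde P^{r,s}_{\tau_i-i+m}(x_j))_{1\le i,j\le m}}{V(x)},\qquad V(x)=\prod_{1\le i<j\le m}(x_i-x_j)$$ (extended by continuity to coinciding coordinates); and $$W^{r,s,m}(y)=V(y)^2\prod_{i=1}^my_i^r(1-y_i)^s\,\mathbf 1_{0<y_m<\cdots<y_1<1}.$$ **Stationary moment.** $$M_n(\infty)=\frac{1}{Z^{r,s,m}}\int\Big(\sum_{i=1}^my_i^n\Big)W^{r,s,m}(y)\,dy,\qquad Z^{r,s,m}=\int W^{r,s,m}(y)\,dy.$$ **Moment formula.** The formula referred to in the claim is $$M_n(t) = M_n(\infty) + \sum_{\substack{\alpha\ \mathrm{hook} \\ |\alpha| = n,\ l(\alpha) \leq m}} (-1)^{n-\alpha_1} \sum_{\substack{\tau \subseteq \alpha \\ \tau \neq \emptyset}} \frac{e^{-\nu_\tau t} \, \tilde{V}_{\alpha_1, \tau_1} \, U_{l(\alpha), l(\tau)}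 }{(d+\tau_1-l(\tau)) (\tau_1+l(\tau)-1)},$$ where $$\tilde{V}_{\alpha_1, \tau_1} = \frac{(d+2\tau_1-1)\Gamma(d+\tau_1)\Gamma(\alpha_1+m)\Gamma(p+\alpha_1)\Gamma(q+\tau_1)}{(\alpha_1-\tau_1)!\,\Gamma(d+\alpha_1+\tau_1)\Gamma(p+\tau_1)\Gamma(\tau_1)},$$ $$U_{l(\alpha), l(\tau)} = \frac{(d+1-2l(\tau))\Gamma(d-l(\alpha)-l(\tau)+1)\Gamma(p-l(\tau)+1)}{(l(\alpha)- l(\tau))!\,(l(\tau)-1)!\,\Gamma(m-l(\alpha)+1)\Gamma(p-l(\alpha)+1)\Gamma(q-l(\tau)+1)\Gamma(d-l(\tau)+1)}.$$ **Hypergeometric series.** ${}_4F_3\left(\begin{matrix}a_1,\dots,a_4\\ b_1,b_2,b_3\end{matrix};1\right)=\sum_{k\ge0}\frac{(a_1)_k\cdots(a_4)_k}{(b_1)_k(b_2)_k(b_3)_k\,k!}$ with $(a)_k=a(a+1)\cdots(a+k-1)$; it terminates when some $a_i$ is a nonpositive integer. *)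

theory Defs
  imports
    "HOL-Probability.Probability"
    "Jordan_Normal_Form.Schur_Decomposition"
begin

section \<open>Partitions\<close>

text \<open>Partitions are padded with zeros and indexed from 0: the value \<open>\<tau> i\<close> is the part
  $\tau_{i+1}$. Containment of partitions is the pointwise order \<open>\<le>\<close> on functions.\<close>

definition partition :: "(nat \<Rightarrow> nat) \<Rightarrow> bool" where
  "partition \<tau> \<longleftrightarrow> antimono \<tau> \<and> finite {i. \<tau> i \<noteq> 0}"

definition plen :: "(nat \<Rightarrow> nat) \<Rightarrow> nat" where
  "plen \<tau> = card {i. \<tau> i \<noteq> 0}"

definition hook :: "nat \<Rightarrow> nat \<Rightarrow> nat \<Rightarrow> nat" where
  "hook n k = (\<lambda>i. if i = 0 then n - k else if i \<le> k then 1 else 0)"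

definition hooks :: "nat \<Rightarrow> (nat \<Rightarrow> nat) set" where
  "hooks n = {hook n k |k. k < n}"

text \<open>With 0-based indices the factor $m-i$ becomes \<open>m - Suc i\<close>.\<close>

definition nu :: "nat \<Rightarrow> nat \<Rightarrow> nat \<Rightarrow> (nat \<Rightarrow> nat) \<Rightarrow> real" where
  "nu r s m \<tau> = (\<Sum>i<m. real (\<tau> i * (\<tau> i + r + s + 1 + 2 * (m - Suc i))))"


section \<open>Hypergeometric series\<close>

definition hypergeom :: "real list \<Rightarrow> real list \<Rightarrow> real \<Rightarrow> real" where
  "hypergeom as bs z = eval_fps (fps_hypergeo as bs 1) z"

definition terminating :: "real list \<Rightarrow> bool" where
  "terminating as \<longleftrightarrow> (\<exists>a\<in>set as. a \<in> \<int>\<^sub>\<le>\<^sub>0)"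

definition balanced :: "real list \<Rightarrow> real list \<Rightarrow> bool" where
  "balanced as bs \<longleftrightarrow> 1 + sum_list as = sum_list bs"


section \<open>Jacobi polynomials and the eigenvalue density\<close>

definition jacobi :: "nat \<Rightarrow> nat \<Rightarrow> nat \<Rightarrow> real \<Rightarrow> real" where
  "jacobi r s k u = pochhammer (real r + 1) k / fact k *
     hypergeom [- real k, real k + real r + real s + 1] [real r + 1] u"

definition jacobi_sqnorm :: "nat \<Rightarrow> nat \<Rightarrow> nat \<Rightarrow> real" where
  "jacobi_sqnorm r s k = (LBINT u:{0..1}. (jacobi r s k u)\<^sup>2 * (u ^ r * (1 - u) ^ s))"

definition vandermonde :: "nat \<Rightarrow> (nat \<Rightarrow> real) \<Rightarrow> real" where
  "vandermonde m x = (\<Prod>j<m. \<Prod>i<j. x i - x j)"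

definition multi_jacobi_quotient ::
    "nat \<Rightarrow> nat \<Rightarrow> nat \<Rightarrow> (nat \<Rightarrow> nat) \<Rightarrow> (nat \<Rightarrow> real) \<Rightarrow> real" where
  "multi_jacobi_quotient r s m \<tau> x =
     Determinant.det (Matrix.mat m m (\<lambda>(i, j). jacobi r s (\<tau> i + (m - Suc i)) (x j))) /
     vandermonde m x"

text \<open>The limit is the extension by continuity to points with coinciding coordinates.\<close>

definition multi_jacobi ::
    "nat \<Rightarrow> nat \<Rightarrow> nat \<Rightarrow> (nat \<Rightarrow> nat) \<Rightarrow> (nat \<Rightarrow> real) \<Rightarrow> real" where
  "multi_jacobi r s m \<tau> x =
     (if inj_on x {..<m} then multi_jacobi_quotient r s m \<tau> x
      else Lim (at x within {z. inj_on z {..<m}}) (multi_jacobi_quotient r s m \<tau>))"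

definition jacobi_weight :: "nat \<Rightarrow> nat \<Rightarrow> nat \<Rightarrow> (nat \<Rightarrow> real) \<Rightarrow> real" where
  "jacobi_weight r s m y =
     (vandermonde m y)\<^sup>2 * (\<Prod>i<m. y i ^ r * (1 - y i) ^ s) *
     of_bool ((\<forall>i<m. 0 < y i \<and> y i < 1) \<and> (\<forall>i j. i < j \<and> j < m \<longrightarrow> y j < y i))"

definition jacobi_density ::
    "nat \<Rightarrow> nat \<Rightarrow> nat \<Rightarrow> real \<Rightarrow> (nat \<Rightarrow> real) \<Rightarrow> (nat \<Rightarrow> real) \<Rightarrow> real" where
  "jacobi_density r s m t x y =
     (\<Sum>\<^sub>\<infinity>\<tau> \<in> {\<tau>. partition \<tau> \<and> plen \<tau> \<le> m}.
        exp (- nu r s m \<tau> * t) * (\<Prod>j<m. 1 / jacobi_sqnorm r s (\<tau> j + (m - Suc j))) *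
        multi_jacobi r s m \<tau> x * multi_jacobi r s m \<tau> y * jacobi_weight r s m y)"

definition stationary_moment :: "nat \<Rightarrow> nat \<Rightarrow> nat \<Rightarrow> nat \<Rightarrow> real" where
  "stationary_moment r s m n =
     1 / (\<integral>y. jacobi_weight r s m y \<partial>(\<Pi>\<^sub>M i\<in>{..<m}. lborel)) *
     (\<integral>y. (\<Sum>i<m. y i ^ n) * jacobi_weight r s m y \<partial>(\<Pi>\<^sub>M i\<in>{..<m}. lborel))"


section \<open>The Hermitian Jacobi process\<close>

definition mat_space :: "nat \<Rightarrow> complex Matrix.mat measure" where
  "mat_space d = vimage_algebra (carrier_mat d d)
     (\<lambda>A. \<lambda>ij\<in>{..<d} \<times> {..<d}. A $$ ij) (\<Pi>\<^sub>M ij\<in>{..<d} \<times> {..<d}. borel)"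

definition unitary_mat :: "nat \<Rightarrow> complex Matrix.mat \<Rightarrow> bool" where
  "unitary_mat d A \<longleftrightarrow> A \<in> carrier_mat d d \<and> A * mat_adjoint A = 1\<^sub>m d"

text \<open>Brownian motion on $U(d)$ for a bi-invariant metric, as a Levy process: it starts at
  the identity, is continuous, and has stationary independent increments whose law is
  invariant under conjugation and inversion. Invariance under conjugation makes the
  second-order part of the generator Ad-invariant, invariance under inversion excludes a
  drift. What remains free is the time scale on $SU(d)$, fixed below through the
  eigenvalue density, and the scale of the scalar $U(1)$ factor, which cancels in
  $X_tX_t^*$.\<close>

definition unitary_brownian_motion ::
    "'a measure \<Rightarrow> nat \<Rightarrow> (real \<Rightarrow> 'a \<Rightarrow> complex Matrix.mat) \<Rightarrow> bool" where
  "unitary_brownian_motion M d Y \<longleftrightarrow>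
     prob_space M \<and>
     (\<forall>t\<ge>0. Y t \<in> measurable M (mat_space d)) \<and>
     (\<forall>t\<ge>0. \<forall>\<omega>\<in>space M. unitary_mat d (Y t \<omega>)) \<and>
     (\<forall>\<omega>\<in>space M. Y 0 \<omega> = 1\<^sub>m d) \<and>
     (\<forall>\<omega>\<in>space M. \<forall>i<d. \<forall>j<d. continuous_on {0..} (\<lambda>t. Y t \<omega> $$ (i, j))) \<and>
     (\<forall>(u :: nat \<Rightarrow> real) N. 0 \<le> u 0 \<and> mono u \<longrightarrow>
        prob_space.indep_vars M (\<lambda>_. mat_space d)
          (\<lambda>k \<omega>. mat_adjoint (Y (u k) \<omega>) * Y (u (Suc k)) \<omega>) {..<N}) \<and>
     (\<forall>a b. 0 \<le> a \<and> a \<le> b \<longrightarrow>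
        distr M (mat_space d) (\<lambda>\<omega>. mat_adjoint (Y a \<omega>) * Y b \<omega>) =
        distr M (mat_space d) (Y (b - a))) \<and>
     (\<forall>t\<ge>0. \<forall>U. unitary_mat d U \<longrightarrow>
        distr M (mat_space d) (\<lambda>\<omega>. U * Y t \<omega> * mat_adjoint U) =
        distr M (mat_space d) (Y t)) \<and>
     (\<forall>t\<ge>0. distr M (mat_space d) (\<lambda>\<omega>. mat_adjoint (Y t \<omega>)) =
        distr M (mat_space d) (Y t))"

definition corner :: "nat \<Rightarrow> nat \<Rightarrow> complex Matrix.mat \<Rightarrow> complex Matrix.mat" where
  "corner m p A = Matrix.mat m p (\<lambda>ij. A $$ ij)"

definition jacobi_matrix ::
    "nat \<Rightarrow> nat \<Rightarrow> (real \<Rightarrow> 'a \<Rightarrow> complex Matrix.mat) \<Rightarrow> real \<Rightarrow> 'a \<Rightarrow> complex Matrix.mat" where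
  "jacobi_matrix m p Y t \<omega> = corner m p (Y t \<omega>) * mat_adjoint (corner m p (Y t \<omega>))"

definition ordered_eigenvalues :: "nat \<Rightarrow> complex Matrix.mat \<Rightarrow> (nat \<Rightarrow> real) \<Rightarrow> bool" where
  "ordered_eigenvalues m A y \<longleftrightarrow>
     char_poly A = (\<Prod>i<m. [:- complex_of_real (y i), 1:]) \<and>
     (\<forall>i j. i \<le> j \<and> j < m \<longrightarrow> y j \<le> y i)"

definition hermitian_jacobi_setup ::
    "'a measure \<Rightarrow> nat \<Rightarrow> nat \<Rightarrow> nat \<Rightarrow> (real \<Rightarrow> 'a \<Rightarrow> complex Matrix.mat) \<Rightarrow> bool" where
  "hermitian_jacobi_setup M m p d Y \<longleftrightarrow>
     unitary_brownian_motion M d Y \<and>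
     (\<forall>t>0. \<exists>y. (\<forall>\<omega>\<in>space M. ordered_eigenvalues m (jacobi_matrix m p Y t \<omega>) (y \<omega>)) \<and>
        distributed M (\<Pi>\<^sub>M i\<in>{..<m}. lborel) y
          (\<lambda>v. ennreal (jacobi_density (p - m) (d - p - m) m t (\<lambda>_. 1) v)))"

text \<open>The trace below is real, since the matrices are Hermitian.\<close>

definition jacobi_moment ::
    "'a measure \<Rightarrow> nat \<Rightarrow> nat \<Rightarrow> (real \<Rightarrow> 'a \<Rightarrow> complex Matrix.mat) \<Rightarrow> nat \<Rightarrow> real \<Rightarrow> real" where
  "jacobi_moment M m p Y n t =
     (\<integral>\<omega>. Re (\<Sum>i<m. (jacobi_matrix m p Y t \<omega> ^\<^sub>m n) $$ (i, i)) \<partial>M)"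


section \<open>The moment formula\<close>

definition Vtilde :: "nat \<Rightarrow> nat \<Rightarrow> nat \<Rightarrow> nat \<Rightarrow> nat \<Rightarrow> nat \<Rightarrow> real" where
  "Vtilde m p q d a1 t1 =
     ((real d + 2 * real t1 - 1) * Gamma (real d + real t1) * Gamma (real a1 + real m) *
        Gamma (real p + real a1) * Gamma (real q + real t1)) /
     (fact (a1 - t1) * Gamma (real d + real a1 + real t1) * Gamma (real p + real t1) *
        Gamma (real t1))"

definition Ucoef :: "nat \<Rightarrow> nat \<Rightarrow> nat \<Rightarrow> nat \<Rightarrow> nat \<Rightarrow> nat \<Rightarrow> real" where
  "Ucoef m p q d la lt =
     ((real d + 1 - 2 * real lt) * Gamma (real d - real la - real lt + 1) *
        Gamma (real p - real lt + 1)) /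
     (fact (la - lt) * fact (lt - 1) * Gamma (real m - real la + 1) *
        Gamma (real p - real la + 1) * Gamma (real q - real lt + 1) *
        Gamma (real d - real lt + 1))"

text \<open>The summand of the moment formula indexed by \<open>\<alpha>\<close> and \<open>\<tau>\<close>, without its sign.\<close>

definition moment_term ::
    "nat \<Rightarrow> nat \<Rightarrow> nat \<Rightarrow> nat \<Rightarrow> nat \<Rightarrow> nat \<Rightarrow> real \<Rightarrow> (nat \<Rightarrow> nat) \<Rightarrow> (nat \<Rightarrow> nat) \<Rightarrow> real" where
  "moment_term m p q d r s t \<alpha> \<tau> =
     exp (- nu r s m \<tau> * t) * Vtilde m p q d (\<alpha> 0) (\<tau> 0) * Ucoef m p q d (plen \<alpha>) (plen \<tau>) /
     ((real d + real (\<tau> 0) - real (plen \<tau>)) * (real (\<tau> 0) + real (plen \<tau>) - 1))"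

definition moment_formula_rhs ::
    "nat \<Rightarrow> nat \<Rightarrow> nat \<Rightarrow> nat \<Rightarrow> nat \<Rightarrow> nat \<Rightarrow> nat \<Rightarrow> real \<Rightarrow> real" where
  "moment_formula_rhs m p q d r s n t =
     stationary_moment r s m n +
     (\<Sum>\<alpha> \<in> {\<alpha> \<in> hooks n. plen \<alpha> \<le> m}. (-1) ^ (n - \<alpha> 0) *
        (\<Sum>\<tau> \<in> {\<tau>. partition \<tau> \<and> \<tau> \<le> \<alpha> \<and> \<tau> \<noteq> (\<lambda>_. 0)}. moment_term m p q d r s t \<alpha> \<tau>))"


section \<open>The inner sum over \<open>\<alpha>\<close>\<close>

text \<open>The factors of \<^const>\<open>moment_term\<close> that do not involve \<open>\<alpha>\<close>.\<close>

definition tau_factor ::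
    "nat \<Rightarrow> nat \<Rightarrow> nat \<Rightarrow> nat \<Rightarrow> nat \<Rightarrow> nat \<Rightarrow> real \<Rightarrow> (nat \<Rightarrow> nat) \<Rightarrow> real" where
  "tau_factor m p q d r s t \<tau> =
     exp (- nu r s m \<tau> * t) /
     ((real d + real (\<tau> 0) - real (plen \<tau>)) * (real (\<tau> 0) + real (plen \<tau>) - 1)) *
     (((real d + 2 * real (\<tau> 0) - 1) * Gamma (real d + real (\<tau> 0)) * Gamma (real q + real (\<tau> 0))) /
        (Gamma (real p + real (\<tau> 0)) * Gamma (real (\<tau> 0)))) *
     (((real d + 1 - 2 * real (plen \<tau>)) * Gamma (real p - real (plen \<tau>) + 1)) /
        (fact (plen \<tau> - 1) * Gamma (real q - real (plen \<tau>) + 1) *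
         Gamma (real d - real (plen \<tau>) + 1)))"

definition hook_sum :: "nat \<Rightarrow> nat \<Rightarrow> nat \<Rightarrow> nat \<Rightarrow> nat \<Rightarrow> nat \<Rightarrow> real" where
  "hook_sum m p d n h j =
     (\<Sum>k = j..j + n - h.
        ((-1) ^ k * Gamma (real n - real k + real m) * Gamma (real p + real n - real k) *
           Gamma (real d - real k - real j - 1)) /
        (fact (n - h + j - k) * fact (k - j) * Gamma (real m - real k) *
           Gamma (real p - real k) * Gamma (real d + real n - real k + real h - real j)))"

definition hook_sum_prefactor :: "nat \<Rightarrow> nat \<Rightarrow> nat \<Rightarrow> nat \<Rightarrow> nat \<Rightarrow> nat \<Rightarrow> real" where
  "hook_sum_prefactor m p d n h j =
     ((-1) ^ (n - h + j) * Gamma (real h - real j + real m) * Gamma (real p + real h - real j) *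
        Gamma (real d - real n + real h - 2 * real j - 1)) /
     (fact (n - h) * Gamma (real d + 2 * real h - 2 * real j) *
        Gamma (real m + real h - real n - real j) * Gamma (real p + real h - real n - real j))"

definition upper_params :: "nat \<Rightarrow> nat \<Rightarrow> nat \<Rightarrow> nat \<Rightarrow> nat \<Rightarrow> nat \<Rightarrow> real list" where
  "upper_params m p d n h j =
     [- (real n - real h), real m + real h - real j, real p + real h - real j,
      real d - real n + real h - 2 * real j - 1]"

definition lower_params :: "nat \<Rightarrow> nat \<Rightarrow> nat \<Rightarrow> nat \<Rightarrow> nat \<Rightarrow> nat \<Rightarrow> real list" where
  "lower_params m p d n h j =
     [real m - real n + real h - real j, real p - real n + real h - real j,
      real d + 2 * real h - 2 * real j]"

end

(* A non-empty partition contained in a hook is a hook, so the double sum ranges over pairs of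
   nested hooks and its order can be reversed. With l(hook n k) = k + 1 and first part n - k, the
   containment of (h - j, 1^j) in (n - k, 1^k) means j \<le> k \<le> j + n - h. Since
   h \<le> n \<le> m \<le> p and p + m \<le> d, every Gamma argument in the inner sum is positive; so
   Gamma (x + k) = Gamma x * (x)_k and k! (N choose k) (-1)^k = (-N)_k, with N = n - h, turn the
   reversed inner sum into a terminating 4F3-series with no vanishing denominator. *)

theory Submission
  imports Defs
begin

section \<open>Terminating hypergeometric series\<close>

text \<open>For k > N the factor (-N)_k contains 0, so the coefficient vanishes whatever
  \<open>bs\<close> is and the \<open>suminf\<close> in \<open>eval_fps\<close> becomes a finite
  sum.\<close>

lemma hypergeom_terminating_eq_sum:
  "hypergeom (- real N # as) bs z =
     (\<Sum>k = 0..N. fps_nth (fps_hypergeo (- real N # as) bs 1) k * z ^ k)"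
proof -
  \<comment> \<open>\<open>fps_hypergeo\<close> multiplies the Pochhammer factors by
    \<open>foldl\<close>; once the head -N has contributed 0, the remaining factors cannot change
    it.\<close>
  have zero: "foldl (\<lambda>x a. x * pochhammer a k) 0 as = 0" for k
    by (induction as) auto
  have "fps_nth (fps_hypergeo (- real N # as) bs 1) k * z ^ k = 0" if "k \<notin> {0..N}" for k
    using that zero by (simp add: pochhammer_of_nat_eq_0_lemma)
  then show ?thesis
    unfolding hypergeom_def eval_fps_def by (intro suminf_finite) auto
qed

text \<open>Reversing the factors gives (-N)_k = (-1)^k (N-k+1)_k, and the rising product
  (N-k+1)...N is a quotient of factorials.\<close>

lemma pochhammer_minus_nat:
  assumes "k \<le> N"
  shows "pochhammer (- real N) k = (-1) ^ k * fact N / fact (N - k)"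
proof -
  have "pochhammer (real (N - k) + 1) k = Gamma (real N + 1) / Gamma (real (N - k) + 1)"
    using assms by (subst pochhammer_Gamma) (auto simp: of_nat_diff nonpos_Ints_def)
  also have "\<dots> = fact N / fact (N - k)"
    using Gamma_fact[where 'a = real] by (simp add: add.commute)
  finally show ?thesis
    using assms by (simp add: pochhammer_minus of_nat_diff)
qed

lemma Gamma_add_nat_eq_pochhammer:
  fixes x :: real
  assumes "0 < x"
  shows "Gamma (x + real k) = Gamma x * pochhammer x k"
proof -
  have "x \<notin> \<int>\<^sub>\<le>\<^sub>0"
    using assms by (auto elim: nonpos_Ints_cases)
  then show ?thesis
    using Gamma_real_pos[OF assms] by (simp add: pochhammer_Gamma)
qed

text \<open>The equality is termwise: (-1)^k / (N-k)! = (-N)_k / N! supplies the first upper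
  parameter, and each Gamma factor shifted by k supplies one further parameter.\<close>

lemma sum_Gamma_quotients_eq_hypergeom:
  fixes a b c e f g :: real
  assumes "0 < a" "0 < b" "0 < c" "0 < e" "0 < f" "0 < g"
  shows "(\<Sum>k = 0..N. (-1) ^ k * Gamma (a + real k) * Gamma (b + real k) * Gamma (c + real k) /
            (fact k * fact (N - k) * Gamma (e + real k) * Gamma (f + real k) * Gamma (g + real k))) =
         Gamma a * Gamma b * Gamma c / (fact N * Gamma e * Gamma f * Gamma g) *
           hypergeom [- real N, a, b, c] [e, f, g] 1"
  unfolding hypergeom_terminating_eq_sum sum_distrib_left
proof (rule sum.cong[OF refl])
  fix k assume "k \<in> {0..N}"
  then have "k \<le> N" by simp
  then show "(-1) ^ k * Gamma (a + real k) * Gamma (b + real k) * Gamma (c + real k) /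
          (fact k * fact (N - k) * Gamma (e + real k) * Gamma (f + real k) * Gamma (g + real k)) =
        Gamma a * Gamma b * Gamma c / (fact N * Gamma e * Gamma f * Gamma g) *
          (fps_nth (fps_hypergeo [- real N, a, b, c] [e, f, g] 1) k * 1 ^ k)"
    using assms by (simp add: Gamma_add_nat_eq_pochhammer pochhammer_minus_nat divide_inverse mult_ac)
qed


section \<open>Hooks\<close>

lemma support_hook: "k < n \<Longrightarrow> {i. hook n k i \<noteq> 0} = {..k}"
  by (auto simp: hook_def)

lemma hook_0: "hook n k 0 = n - k"
  by (simp add: hook_def)

lemma plen_hook: "k < n \<Longrightarrow> plen (hook n k) = Suc k"
  unfolding plen_def by (subst support_hook) simp_all

lemma partition_hook:
  assumes "k < n"
  shows "partition (hook n k)"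
proof -
  have "antimono (hook n k)"
    using assms by (auto simp: antimono_def hook_def)
  then show ?thesis
    unfolding partition_def support_hook[OF assms] by simp
qed

text \<open>Beyond the first part a hook has only ones and zeros, so containment is decided by the
  first part and the last nonzero index.\<close>

lemma hook_le_iff:
  assumes "j < h" "k < n"
  shows "hook h j \<le> hook n k \<longleftrightarrow> h - j \<le> n - k \<and> j \<le> k"
proof
  assume le: "hook h j \<le> hook n k"
  have "h - j \<le> n - k"
    using le_funD[OF le, of 0] by (simp add: hook_0)
  \<comment> \<open>Index j lies in the support of the smaller hook, hence in the support {..k} of
    the larger one.\<close>
  moreover have "hook n k j \<noteq> 0"
    using le_funD[OF le, of j] assms by (auto simp: hook_def split: if_splits)
  then have "j \<le> k"
    using support_hook[OF assms(2)] by blast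
  ultimately show "h - j \<le> n - k \<and> j \<le> k" ..
next
  assume "h - j \<le> n - k \<and> j \<le> k"
  then show "hook h j \<le> hook n k"
    by (auto simp: le_fun_def hook_def)
qed

lemma hook_eqD:
  assumes "j < h" "j' < h'" "hook h j = hook h' j'"
  shows "h = h' \<and> j = j'"
  using assms plen_hook[of j h] plen_hook[of j' h'] hook_0[of h j] hook_0[of h' j'] by auto

text \<open>Monotonicity makes the support an initial segment, and the bounding hook forces every
  part after the first to be at most 1.\<close>

lemma partition_le_hook_obtains:
  assumes "partition \<tau>" "\<tau> \<le> hook n k" "\<tau> \<noteq> (\<lambda>_. 0)" "k < n"
  obtains h j where "j < h" "h \<le> n" "\<tau> = hook h j"
proof -
  let ?S = "{i. \<tau> i \<noteq> 0}"
  have anti: "\<tau> j \<le> \<tau> i" if "i \<le> j" for i j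
    using assms(1) that by (auto simp: partition_def antimono_def)
  have fin: "finite ?S"
    using assms(1) by (simp add: partition_def)
  have ne: "?S \<noteq> {}"
    using assms(3) by auto
  \<comment> \<open>With 0-based indices the last nonzero position is the number of ones below the
    first part, so the weight is \<open>\<tau> 0 + j\<close>.\<close>
  define j where "j = Max ?S"
  have "\<tau> j \<noteq> 0"
    using Max_in[OF fin ne] by (simp add: j_def)
  then have pos: "\<tau> i > 0" if "i \<le> j" for i
    using anti[OF that] by simp
  have zero: "\<tau> i = 0" if "\<not> i \<le> j" for i
    using that Max_ge[OF fin, of i] unfolding j_def by auto
  have le1: "\<tau> i \<le> 1" if "i \<noteq> 0" for i
    using le_funD[OF assms(2), of i] that by (auto simp: hook_def split: if_splits)
  have eq: "\<tau> = hook (\<tau> 0 + j) j"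
  proof
    fix i
    show "\<tau> i = hook (\<tau> 0 + j) j i"
      using pos[of i] zero[of i] le1[of i] by (cases "i \<le> j") (auto simp: hook_def)
  qed
  have "j < \<tau> 0 + j"
    using pos[of 0] by simp
  \<comment> \<open>Adding the two inequalities of \<open>hook_le_iff\<close>, h - j \<le> n - k and
    j \<le> k, yields h \<le> n.\<close>
  moreover from this have "\<tau> 0 + j \<le> n"
    using hook_le_iff[of j "\<tau> 0 + j" k n] assms(2,4) eq by auto
  ultimately show ?thesis
    using eq that by blast
qed

text \<open>On the right, k enters only through the containment; the pairs (h, j) form a fixed
  finite set, as the exchange of sums requires.\<close>

lemma partitions_le_hook:
  assumes "k < n"
  shows "{\<tau>. partition \<tau> \<and> \<tau> \<le> hook n k \<and> \<tau> \<noteq> (\<lambda>_. 0)} =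
    {\<tau>. \<tau> \<in> (\<lambda>(h, j). hook h j) ` (SIGMA h:{1..n}. {0..h - 1}) \<and> \<tau> \<le> hook n k}"
    (is "?L = ?R")
proof
  show "?L \<subseteq> ?R"
  proof
    fix \<tau> assume "\<tau> \<in> ?L"
    then obtain h j where "j < h" "h \<le> n" "\<tau> = hook h j"
      using partition_le_hook_obtains assms by blast
    then have "\<tau> = (\<lambda>(h, j). hook h j) (h, j)" "(h, j) \<in> (SIGMA h:{1..n}. {0..h - 1})"
      by auto
    then show "\<tau> \<in> ?R"
      using \<open>\<tau> \<in> ?L\<close> by blast
  qed
  show "?R \<subseteq> ?L"
  proof
    fix \<tau> assume "\<tau> \<in> ?R"
    then obtain h j where "(h, j) \<in> (SIGMA h:{1..n}. {0..h - 1})"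
      and \<tau>: "\<tau> = hook h j" "\<tau> \<le> hook n k"
      by (auto simp del: One_nat_def)
    then have "j < h"
      by auto
    then have "\<tau> 0 \<noteq> 0"
      by (simp add: \<tau>(1) hook_0)
    then have "\<tau> \<noteq> (\<lambda>_. 0)"
      by auto
    then show "\<tau> \<in> ?L"
      using partition_hook[OF \<open>j < h\<close>] \<tau> by blast
  qed
qed

text \<open>The upper end of the range is the condition h - j \<le> n - k, and n \<le> m gives
  length k + 1 \<le> m.\<close>

lemma hooks_containing_hook:
  assumes "1 \<le> h" "h \<le> n" "j \<le> h - 1" "n \<le> m"
  shows "{\<alpha> \<in> hooks n. plen \<alpha> \<le> m \<and> hook h j \<le> \<alpha>} = hook n ` {j..j + n - h}"
proof -
  have "{\<alpha> \<in> hooks n. plen \<alpha> \<le> m \<and> hook h j \<le> \<alpha>} =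
      hook n ` {k. k < n \<and> plen (hook n k) \<le> m \<and> hook h j \<le> hook n k}"
    by (auto simp: hooks_def)
  also have "{k. k < n \<and> plen (hook n k) \<le> m \<and> hook h j \<le> hook n k} = {j..j + n - h}"
    using assms by (auto simp: plen_hook hook_le_iff)
  finally show ?thesis .
qed

lemma inj_on_hook: "inj_on (hook n) {..<n}"
  by (auto intro!: inj_onI dest: hook_eqD)


section \<open>The sum over the hooks containing a fixed hook\<close>

lemma moment_term_hook:
  assumes "j < h" "k < n" "j \<le> k" "k \<le> j + n - h" "h \<le> n"
  shows "(-1) ^ (n - hook n k 0) * moment_term m p q d r s t (hook n k) (hook h j) =
    tau_factor m p q d r s t (hook h j) *
      (((-1) ^ k * Gamma (real n - real k + real m) * Gamma (real p + real n - real k) *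
           Gamma (real d - real k - real j - 1)) /
        (fact (n - h + j - k) * fact (k - j) * Gamma (real m - real k) *
           Gamma (real p - real k) * Gamma (real d + real n - real k + real h - real j)))"
proof -
  have idx: "n - (n - k) = k" "n - k - (h - j) = n - h + j - k"
    using assms by auto
  \<comment> \<open>The lengths are k + 1 and j + 1, whence the shifts by one in the Gamma
    arguments.\<close>
  have args: "real d - real (Suc k) - real (Suc j) + 1 = real d - real k - real j - 1"
    "real m - real (Suc k) + 1 = real m - real k"
    "real p - real (Suc k) + 1 = real p - real k"
    "real (n - k) + real m = real n - real k + real m"
    "real p + real (n - k) = real p + real n - real k"
    "real d + real (n - k) + real (h - j) = real d + real n - real k + real h - real j"
    using assms by (simp_all add: of_nat_diff)
  show ?thesis
    unfolding moment_term_def tau_factor_def Vtilde_def Ucoef_def hook_0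
      plen_hook[OF assms(1)] plen_hook[OF assms(2)] idx args
    by (simp add: divide_inverse mult_ac)
qed

lemma sum_moment_term_hooks:
  assumes "1 \<le> h" "h \<le> n" "j \<le> h - 1" "n \<le> m"
  shows "(\<Sum>\<alpha> \<in> {\<alpha> \<in> hooks n. plen \<alpha> \<le> m \<and> hook h j \<le> \<alpha>}.
            (-1) ^ (n - \<alpha> 0) * moment_term m p q d r s t \<alpha> (hook h j)) =
          tau_factor m p q d r s t (hook h j) * hook_sum m p d n h j"
proof -
  \<comment> \<open>Since j < h, every such k is below n, where \<open>hook n\<close> is
    injective.\<close>
  have "{j..j + n - h} \<subseteq> {..<n}"
    using assms by auto
  then have inj: "inj_on (hook n) {j..j + n - h}"
    by (rule inj_on_subset[OF inj_on_hook])
  show ?thesis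
    unfolding hooks_containing_hook[OF assms] sum.reindex[OF inj] hook_sum_def sum_distrib_left o_def
    using assms by (intro sum.cong[OF refl] moment_term_hook) auto
qed

text \<open>The map k -> n-h+j-k is its own inverse, exchanges the ranges {j..j+n-h} and {0..n-h},
  and turns Gamma arguments decreasing in k into a base plus the index.\<close>

lemma hook_sum_reversed:
  assumes "1 \<le> h" "h \<le> n" "j \<le> h - 1"
  shows "hook_sum m p d n h j = (-1) ^ (n - h + j) *
     (\<Sum>k = 0..n - h.
        ((-1) ^ k * Gamma (real h - real j + real m + real k) *
           Gamma (real p + real h - real j + real k) *
           Gamma (real d - real n + real h - 2 * real j - 1 + real k)) /
        (fact k * fact (n - h - k) * Gamma (real m + real h - real n - real j + real k) *
           Gamma (real p + real h - real n - real j + real k) *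
           Gamma (real d + real k + 2 * real h - 2 * real j)))"
  unfolding hook_sum_def sum_distrib_left
proof (rule sum.reindex_bij_witness[where i = "\<lambda>k. n - h + j - k" and j = "\<lambda>k. n - h + j - k"])
  fix k assume k: "k \<in> {j..j + n - h}"
  define l where "l = n - h + j - k"
  have kl: "k = n - h + j - l" "l \<le> n - h" "k - j = n - h - l"
    and real_k: "real k = real n - real h + real j - real l"
    using k assms by (auto simp: l_def)
  \<comment> \<open>k and (n-h+j) + l have the same parity, because k = (n-h+j) - l.\<close>
  have sign: "(-1::real) ^ k = (-1) ^ (n - h + j) * (-1) ^ l"
    using kl by (simp add: minus_one_power_iff)
  have args: "real h - real j + real m + real l = real n - real k + real m"
    "real p + real h - real j + real l = real p + real n - real k"
    "real d - real n + real h - 2 * real j - 1 + real l = real d - real k - real j - 1"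
    "real m + real h - real n - real j + real l = real m - real k"
    "real p + real h - real n - real j + real l = real p - real k"
    "real d + real l + 2 * real h - 2 * real j = real d + real n - real k + real h - real j"
    by (simp_all add: real_k)
  show "(-1) ^ (n - h + j) *
        (((-1) ^ (n - h + j - k) * Gamma (real h - real j + real m + real (n - h + j - k)) *
           Gamma (real p + real h - real j + real (n - h + j - k)) *
           Gamma (real d - real n + real h - 2 * real j - 1 + real (n - h + j - k))) /
        (fact (n - h + j - k) * fact (n - h - (n - h + j - k)) *
           Gamma (real m + real h - real n - real j + real (n - h + j - k)) *
           Gamma (real p + real h - real n - real j + real (n - h + j - k)) *
           Gamma (real d + real (n - h + j - k) + 2 * real h - 2 * real j))) =
      ((-1) ^ k * Gamma (real n - real k + real m) * Gamma (real p + real n - real k) *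
           Gamma (real d - real k - real j - 1)) /
        (fact (n - h + j - k) * fact (k - j) * Gamma (real m - real k) *
           Gamma (real p - real k) * Gamma (real d + real n - real k + real h - real j))"
    unfolding l_def[symmetric] args kl(3) sign by (simp add: mult_ac)
qed (use assms in auto)

lemma hook_sum_eq_hypergeom:
  assumes "1 \<le> h" "h \<le> n" "j \<le> h - 1" "n \<le> m" "m \<le> p" "p + m \<le> d"
  shows "hook_sum m p d n h j = hook_sum_prefactor m p d n h j *
           hypergeom (upper_params m p d n h j) (lower_params m p d n h j) 1"
proof -
  have N: "- (real n - real h) = - real (n - h)"
    using assms by simp
  have g: "real d + real k + 2 * real h - 2 * real j = real d + 2 * real h - 2 * real j + real k" for k
    by simp
  have lower: "real m - real n + real h - real j = real m + real h - real n - real j"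
    "real p - real n + real h - real j = real p + real h - real n - real j"
    and upper: "real m + real h - real j = real h - real j + real m"
    by simp_all
  \<comment> \<open>Positivity of the six bases: m+h-n-j and p+h-n-j are at least h-j, and
    d-n+h-2j-1 \<ge> 2(h-j)-1 because d \<ge> p+m \<ge> 2n and h \<le> n; the other three are clear
    from j < h.\<close>
  show ?thesis
    unfolding hook_sum_reversed[OF assms(1-3)] hook_sum_prefactor_def upper_params_def
      lower_params_def N g lower upper
    using assms by (subst sum_Gamma_quotients_eq_hypergeom) (simp_all add: mult_ac)
qed

lemma terminating_upper_params: "h \<le> n \<Longrightarrow> terminating (upper_params m p d n h j)"
  by (auto simp: terminating_def upper_params_def simp flip: of_nat_diff)

text \<open>Both sides equal m + p + d - 2n + 4h - 4j.\<close>

lemma balanced_params: "balanced (upper_params m p d n h j) (lower_params m p d n h j)"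
  by (simp add: balanced_def upper_params_def lower_params_def)


section \<open>Reversing the order of summation\<close>

lemma moment_formula_rhs_eq_hook_sums:
  assumes "n \<le> m"
  shows "moment_formula_rhs m p q d r s n t = stationary_moment r s m n +
    (\<Sum>h = 1..n. \<Sum>j = 0..h - 1. tau_factor m p q d r s t (hook h j) * hook_sum m p d n h j)"
proof -
  let ?P = "SIGMA h:{1..n}. {0..h - 1}"
  let ?H = "(\<lambda>(h, j). hook h j) ` ?P"
  let ?A = "{\<alpha> \<in> hooks n. plen \<alpha> \<le> m}"
  let ?g = "\<lambda>\<alpha> \<tau>. (-1) ^ (n - \<alpha> 0) * moment_term m p q d r s t \<alpha> \<tau>"
  have "hooks n = hook n ` {..<n}"
    by (auto simp: hooks_def)
  then have finA: "finite ?A"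
    by simp
  have inj: "inj_on (\<lambda>(h, j). hook h j) ?P"
  proof (rule inj_onI, clarsimp)
    fix h j h' j'
    assume "Suc 0 \<le> h" "j \<le> h - Suc 0" "Suc 0 \<le> h'" "j' \<le> h' - Suc 0" "hook h j = hook h' j'"
    then show "h = h' \<and> j = j'"
      by (intro hook_eqD) auto
  qed
  \<comment> \<open>The sign moves inside and the inner range becomes \<open>?H\<close> cut by
    containment, so that \<open>sum.swap_restrict\<close> applies.\<close>
  have "(\<Sum>\<alpha>\<in>?A. (-1) ^ (n - \<alpha> 0) *
      (\<Sum>\<tau> \<in> {\<tau>. partition \<tau> \<and> \<tau> \<le> \<alpha> \<and> \<tau> \<noteq> (\<lambda>_. 0)}. moment_term m p q d r s t \<alpha> \<tau>)) =
      (\<Sum>\<alpha>\<in>?A. \<Sum>\<tau> | \<tau> \<in> ?H \<and> \<tau> \<le> \<alpha>. ?g \<alpha> \<tau>)"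
  proof (rule sum.cong[OF refl])
    fix \<alpha> assume "\<alpha> \<in> ?A"
    then obtain k where "k < n" "\<alpha> = hook n k"
      by (auto simp: hooks_def)
    then show "(-1) ^ (n - \<alpha> 0) *
        (\<Sum>\<tau> \<in> {\<tau>. partition \<tau> \<and> \<tau> \<le> \<alpha> \<and> \<tau> \<noteq> (\<lambda>_. 0)}. moment_term m p q d r s t \<alpha> \<tau>) =
        (\<Sum>\<tau> | \<tau> \<in> ?H \<and> \<tau> \<le> \<alpha>. ?g \<alpha> \<tau>)"
      by (simp only: partitions_le_hook sum_distrib_left)
  qed
  also have "\<dots> = (\<Sum>\<tau>\<in>?H. \<Sum>\<alpha> | \<alpha> \<in> ?A \<and> \<tau> \<le> \<alpha>. ?g \<alpha> \<tau>)"
    by (rule sum.swap_restrict[OF finA]) auto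
  \<comment> \<open>A hook determines its pair (h, j), so summing over hooks is summing over
    pairs.\<close>
  also have "\<dots> = (\<Sum>(h, j)\<in>?P. \<Sum>\<alpha> | \<alpha> \<in> ?A \<and> hook h j \<le> \<alpha>. ?g \<alpha> (hook h j))"
    by (subst sum.reindex[OF inj]) (simp add: case_prod_unfold)
  also have "\<dots> = (\<Sum>h = 1..n. \<Sum>j = 0..h - 1. \<Sum>\<alpha> | \<alpha> \<in> ?A \<and> hook h j \<le> \<alpha>. ?g \<alpha> (hook h j))"
    by (subst sum.Sigma) auto
  also have "\<dots> = (\<Sum>h = 1..n. \<Sum>j = 0..h - 1.
      tau_factor m p q d r s t (hook h j) * hook_sum m p d n h j)"
  proof (intro sum.cong[OF refl])
    fix h j assume "h \<in> {1..n}" "j \<in> {0..h - 1}"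
    then show "(\<Sum>\<alpha> | \<alpha> \<in> ?A \<and> hook h j \<le> \<alpha>. ?g \<alpha> (hook h j)) =
        tau_factor m p q d r s t (hook h j) * hook_sum m p d n h j"
      using sum_moment_term_hooks[of h n j m p q d r s t] assms by (simp add: conj_assoc)
  qed
  finally show ?thesis
    unfolding moment_formula_rhs_def by simp
qed

text \<open>For the process the conclusion is an equivalence: the moment formula holds exactly when
  its rewritten form does, since the two right-hand sides agree.\<close>

theorem mainTheorem2:
  fixes m p d r s q n :: nat and t :: real
    and M :: "'a measure" and Y :: "real \<Rightarrow> 'a \<Rightarrow> complex Matrix.mat"
  assumes "1 \<le> m" and "1 \<le> p" and "1 \<le> d"
    and "int r = int p - int m" and "int s = int d - int p - int m" and "int q = int d - int p"
    and "1 \<le> n" and "n \<le> m" and "0 < t"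
  shows
    "moment_formula_rhs m p q d r s n t =
       stationary_moment r s m n +
       (\<Sum>h = 1..n. \<Sum>j = 0..h - 1.
          tau_factor m p q d r s t (hook h j) * hook_sum_prefactor m p d n h j *
          hypergeom (upper_params m p d n h j) (lower_params m p d n h j) 1) \<and>
     (hermitian_jacobi_setup M m p d Y \<longrightarrow>
       (jacobi_moment M m p Y n t = moment_formula_rhs m p q d r s n t \<longleftrightarrow>
        jacobi_moment M m p Y n t =
          stationary_moment r s m n +
          (\<Sum>h = 1..n. \<Sum>j = 0..h - 1.
             tau_factor m p q d r s t (hook h j) * hook_sum_prefactor m p d n h j *
             hypergeom (upper_params m p d n h j) (lower_params m p d n h j) 1))) \<and>
     (\<forall>h j. 1 \<le> h \<and> h \<le> n \<and> j \<le> h - 1 \<longrightarrow>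
       {\<alpha> \<in> hooks n. plen \<alpha> \<le> m \<and> hook h j \<le> \<alpha>} = hook n ` {j..j + n - h} \<and>
       (\<Sum>\<alpha> \<in> {\<alpha> \<in> hooks n. plen \<alpha> \<le> m \<and> hook h j \<le> \<alpha>}.
          (-1) ^ (n - \<alpha> 0) * moment_term m p q d r s t \<alpha> (hook h j)) =
         tau_factor m p q d r s t (hook h j) * hook_sum m p d n h j \<and>
       hook_sum m p d n h j =
         (-1) ^ (n - h + j) *
         (\<Sum>k = 0..n - h.
            ((-1) ^ k * Gamma (real h - real j + real m + real k) *
               Gamma (real p + real h - real j + real k) *
               Gamma (real d - real n + real h - 2 * real j - 1 + real k)) /
            (fact k * fact (n - h - k) * Gamma (real m + real h - real n - real j + real k) *
               Gamma (real p + real h - real n - real j + real k) *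
               Gamma (real d + real k + 2 * real h - 2 * real j))) \<and>
       hook_sum m p d n h j =
         hook_sum_prefactor m p d n h j *
         hypergeom (upper_params m p d n h j) (lower_params m p d n h j) 1 \<and>
       terminating (upper_params m p d n h j) \<and>
       balanced (upper_params m p d n h j) (lower_params m p d n h j))"
proof -
  \<comment> \<open>As r and s are natural numbers, the integer equations defining them force both
    inequalities.\<close>
  have le: "m \<le> p" "p + m \<le> d"
    using assms by linarith+
  have rhs: "moment_formula_rhs m p q d r s n t =
       stationary_moment r s m n +
       (\<Sum>h = 1..n. \<Sum>j = 0..h - 1.
          tau_factor m p q d r s t (hook h j) * hook_sum_prefactor m p d n h j *
          hypergeom (upper_params m p d n h j) (lower_params m p d n h j) 1)"
    unfolding moment_formula_rhs_eq_hook_sums[OF \<open>n \<le> m\<close>]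
    using \<open>n \<le> m\<close> le by (auto intro!: sum.cong simp: hook_sum_eq_hypergeom)
  show ?thesis
  \<comment> \<open>Rewriting with \<open>rhs\<close> makes the two sides of the equivalence
    identical, so reflexivity closes it.\<close>
  proof (intro conjI impI allI rhs; (unfold rhs, rule refl)?)
    fix h j assume "1 \<le> h \<and> h \<le> n \<and> j \<le> h - 1"
    then have hj: "1 \<le> h" "h \<le> n" "j \<le> h - 1"
      by simp_all
    show "{\<alpha> \<in> hooks n. plen \<alpha> \<le> m \<and> hook h j \<le> \<alpha>} = hook n ` {j..j + n - h}"
      using hooks_containing_hook[OF hj \<open>n \<le> m\<close>] .
    show "(\<Sum>\<alpha> \<in> {\<alpha> \<in> hooks n. plen \<alpha> \<le> m \<and> hook h j \<le> \<alpha>}.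
          (-1) ^ (n - \<alpha> 0) * moment_term m p q d r s t \<alpha> (hook h j)) =
         tau_factor m p q d r s t (hook h j) * hook_sum m p d n h j"
      using sum_moment_term_hooks[OF hj \<open>n \<le> m\<close>] .
  qed ((elim conjE, rule hook_sum_reversed hook_sum_eq_hypergeom[OF _ _ _ \<open>n \<le> m\<close> le]
      terminating_upper_params balanced_params; assumption)+)
qed

end
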